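(* Let $m$ be a positive integer such that $m=a^2+b^2+c^2$ for some integers $a,b,c$. If $m\notin\{1,2,3,14\}$, then there are integers $x,y,z$ such that $x^2+y^2+z^2=9m$, $xyz\not\equiv 0\pmod 3$, and $(x^2-1)(y^2-1)(z^2-1)\neq 0$. *)

theory Defs
  imports Complex_Main "HOL-Number_Theory.Cong"
begin

end

theory Submission
  imports Defs
begin

text \<open>
  The triple \<open>(x, y, z) = (2b + 2c - a, 2a + 2c - b, 2a + 2b - c)\<close> is 3 times a reflection of
  \<open>(a, b, c)\<close>, so \<open>x\<^sup>2 + y\<^sup>2 + z\<^sup>2 = 9(a\<^sup>2 + b\<^sup>2 + c\<^sup>2)\<close>. As \<open>x, y, z\<close> are congruent to
  \<open>2(a + b + c)\<close> modulo 3, they are prime to 3 as soon as \<open>a + b + c\<close> is. By descent, \<open>m\<close> is a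
  sum of squares of \<open>0 \<le> a \<le> b \<le> c\<close>, not all divisible by 3, and it remains to choose signs so
  that 3 does not divide \<open>\<plusminus>a \<plusminus> b \<plusminus> c\<close> and no entry of the scaled reflection is \<open>\<plusminus>1\<close>.

  Here \<open>c \<ge> 2\<close>, as \<open>m\<close> is not 1, 2 or 3. The choice \<open>(a, b, -c)\<close> then makes all entries large
  unless \<open>a = 1\<close> and \<open>b = c\<close>. If it is not available, that is, if 3 divides \<open>a + b - c\<close>, at least
  two of the other choices are, and they all produce an entry \<open>\<plusminus>1\<close> only if \<open>(a, b, c)\<close> is, up to a
  common sign, on one of the lines \<open>(0, 3u - 1, 6u - 1)\<close>, \<open>(6u - 1, 6u + 1, 9u)\<close> and
  \<open>(6u + 1, 15u + 2, 18u + 3)\<close>. There the unscaled reflection of \<open>(a, b, -c)\<close> is integral and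
  provides a second representation of \<open>m\<close>, for which some choice of signs works when \<open>u \<noteq> 0\<close>.
\<close>

definition admissible_sum :: "int \<Rightarrow> bool" where
  "admissible_sum n \<longleftrightarrow>
     (\<exists>x y z. n = x\<^sup>2 + y\<^sup>2 + z\<^sup>2 \<and> \<not> 3 dvd x \<and> \<not> 3 dvd y \<and> \<not> 3 dvd z
        \<and> \<bar>x\<bar> \<noteq> 1 \<and> \<bar>y\<bar> \<noteq> 1 \<and> \<bar>z\<bar> \<noteq> 1)"

section \<open>Scaled reflections\<close>

lemma sum_squares_reflection:
  fixes a b c :: "'a::comm_ring_1"
  shows "(2 * b + 2 * c - a)\<^sup>2 + (2 * a + 2 * c - b)\<^sup>2 + (2 * a + 2 * b - c)\<^sup>2
           = 9 * (a\<^sup>2 + b\<^sup>2 + c\<^sup>2)"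
  by (simp add: power2_eq_square algebra_simps)

lemma not_3_dvd_reflection:
  fixes a b c :: int
  assumes "\<not> 3 dvd a + b + c"
  shows "\<not> 3 dvd 2 * b + 2 * c - a" "\<not> 3 dvd 2 * a + 2 * c - b" "\<not> 3 dvd 2 * a + 2 * b - c"
  using assms by presburger+

definition reflects_to_unit :: "int \<Rightarrow> int \<Rightarrow> int \<Rightarrow> bool" where
  "reflects_to_unit a b c \<longleftrightarrow>
     \<bar>2 * b + 2 * c - a\<bar> = 1 \<or> \<bar>2 * a + 2 * c - b\<bar> = 1 \<or> \<bar>2 * a + 2 * b - c\<bar> = 1"

lemma admissible_sum_reflection:
  assumes "\<not> 3 dvd a + b + c" "\<not> reflects_to_unit a b c"
  shows "admissible_sum (9 * (a\<^sup>2 + b\<^sup>2 + c\<^sup>2))"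
  using not_3_dvd_reflection[OF assms(1)] assms(2) sum_squares_reflection[of b c a]
  unfolding admissible_sum_def reflects_to_unit_def by metis

lemma admissible_sum_reflection_signs:
  shows "\<not> 3 dvd - a + b + c \<Longrightarrow> \<not> reflects_to_unit (- a) b c \<Longrightarrow>
      admissible_sum (9 * (a\<^sup>2 + b\<^sup>2 + c\<^sup>2))"
    and "\<not> 3 dvd a - b + c \<Longrightarrow> \<not> reflects_to_unit a (- b) c \<Longrightarrow>
      admissible_sum (9 * (a\<^sup>2 + b\<^sup>2 + c\<^sup>2))"
    and "\<not> 3 dvd a + b - c \<Longrightarrow> \<not> reflects_to_unit a b (- c) \<Longrightarrow>
      admissible_sum (9 * (a\<^sup>2 + b\<^sup>2 + c\<^sup>2))"
  using admissible_sum_reflection[of "- a" b c] admissible_sum_reflection[of a "- b" c]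
    admissible_sum_reflection[of a b "- c"] by simp_all

lemma admissible_sum_reflection_middle_sign:
  assumes "\<not> 3 dvd a + c" "\<not> reflects_to_unit a b c" "\<not> reflects_to_unit a (- b) c"
  shows "admissible_sum (9 * (a\<^sup>2 + b\<^sup>2 + c\<^sup>2))"
proof -
  have "\<not> 3 dvd a + b + c \<or> \<not> 3 dvd a - b + c"
    using assms(1) by presburger
  with assms(2,3) show ?thesis
    by (blast intro: admissible_sum_reflection admissible_sum_reflection_signs(2))
qed

section \<open>Representations with entries not all divisible by 3\<close>

lemma exists_signs_sum_not_3_dvd:
  fixes a b c :: int
  assumes "\<not> (3 dvd a \<and> 3 dvd b \<and> 3 dvd c)"
  obtains a' b' c' where "a'\<^sup>2 = a\<^sup>2" "b'\<^sup>2 = b\<^sup>2" "c'\<^sup>2 = c\<^sup>2" "\<not> 3 dvd a' + b' + c'"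
proof -
  have "\<not> 3 dvd a + b + c \<or> \<not> 3 dvd - a + b + c \<or> \<not> 3 dvd a + - b + c \<or> \<not> 3 dvd a + b + - c"
    using assms by presburger
  then show ?thesis
    using that[of a b c] that[of "- a" b c] that[of a "- b" c] that[of a b "- c"] by auto
qed

lemma exists_rep_not_all_3_dvd:
  fixes a b c :: int
  assumes "0 < a\<^sup>2 + b\<^sup>2 + c\<^sup>2"
  shows "\<exists>x y z. a\<^sup>2 + b\<^sup>2 + c\<^sup>2 = x\<^sup>2 + y\<^sup>2 + z\<^sup>2 \<and> \<not> (3 dvd x \<and> 3 dvd y \<and> 3 dvd z)"
  using assms
proof (induction "nat (a\<^sup>2 + b\<^sup>2 + c\<^sup>2)" arbitrary: a b c rule: less_induct)
  case less
  show ?case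
  proof (cases "3 dvd a \<and> 3 dvd b \<and> 3 dvd c")
    case False
    then show ?thesis by blast
  next
    case True
    then obtain p q r where "a = 3 * p" "b = 3 * q" "c = 3 * r"
      by (auto elim!: dvdE)
    then have nine: "a\<^sup>2 + b\<^sup>2 + c\<^sup>2 = 9 * (p\<^sup>2 + q\<^sup>2 + r\<^sup>2)"
      by (simp add: power_mult_distrib)
    with less.prems have "0 < p\<^sup>2 + q\<^sup>2 + r\<^sup>2" "nat (p\<^sup>2 + q\<^sup>2 + r\<^sup>2) < nat (a\<^sup>2 + b\<^sup>2 + c\<^sup>2)"
      by (simp_all add: nat_less_eq_zless)
    from less.hyps[OF this(2,1)] obtain x y z where
      rep: "p\<^sup>2 + q\<^sup>2 + r\<^sup>2 = x\<^sup>2 + y\<^sup>2 + z\<^sup>2" and not_all: "\<not> (3 dvd x \<and> 3 dvd y \<and> 3 dvd z)"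
      by blast
    obtain x' y' z' where signs: "x'\<^sup>2 = x\<^sup>2" "y'\<^sup>2 = y\<^sup>2" "z'\<^sup>2 = z\<^sup>2"
      and "\<not> 3 dvd x' + y' + z'"
      using exists_signs_sum_not_3_dvd[OF not_all] .
    moreover have "a\<^sup>2 + b\<^sup>2 + c\<^sup>2
        = (2 * y' + 2 * z' - x')\<^sup>2 + (2 * x' + 2 * z' - y')\<^sup>2 + (2 * x' + 2 * y' - z')\<^sup>2"
      unfolding sum_squares_reflection signs nine rep ..
    ultimately show ?thesis
      using not_3_dvd_reflection(1) by blast
  qed
qed

lemma exists_sorted_rep_not_all_3_dvd:
  fixes a b c :: int
  assumes "0 < a\<^sup>2 + b\<^sup>2 + c\<^sup>2"
  shows "\<exists>x y z. a\<^sup>2 + b\<^sup>2 + c\<^sup>2 = x\<^sup>2 + y\<^sup>2 + z\<^sup>2 \<and> \<not> (3 dvd x \<and> 3 dvd y \<and> 3 dvd z)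
    \<and> 0 \<le> x \<and> x \<le> y \<and> y \<le> z"
proof -
  obtain x y z where rep: "a\<^sup>2 + b\<^sup>2 + c\<^sup>2 = x\<^sup>2 + y\<^sup>2 + z\<^sup>2" "\<not> (3 dvd x \<and> 3 dvd y \<and> 3 dvd z)"
    using exists_rep_not_all_3_dvd[OF assms] by blast
  have sorted_case: ?thesis
    if "\<bar>p\<bar> \<le> \<bar>q\<bar>" "\<bar>q\<bar> \<le> \<bar>r\<bar>" "x\<^sup>2 + y\<^sup>2 + z\<^sup>2 = p\<^sup>2 + q\<^sup>2 + r\<^sup>2"
      "\<not> (3 dvd p \<and> 3 dvd q \<and> 3 dvd r)" for p q r
    using that rep(1) by (intro exI[of _ "\<bar>p\<bar>"] exI[of _ "\<bar>q\<bar>"] exI[of _ "\<bar>r\<bar>"]) simp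
  consider "\<bar>x\<bar> \<le> \<bar>y\<bar>" "\<bar>y\<bar> \<le> \<bar>z\<bar>" | "\<bar>x\<bar> \<le> \<bar>z\<bar>" "\<bar>z\<bar> \<le> \<bar>y\<bar>" | "\<bar>y\<bar> \<le> \<bar>x\<bar>" "\<bar>x\<bar> \<le> \<bar>z\<bar>"
    | "\<bar>y\<bar> \<le> \<bar>z\<bar>" "\<bar>z\<bar> \<le> \<bar>x\<bar>" | "\<bar>z\<bar> \<le> \<bar>x\<bar>" "\<bar>x\<bar> \<le> \<bar>y\<bar>" | "\<bar>z\<bar> \<le> \<bar>y\<bar>" "\<bar>y\<bar> \<le> \<bar>x\<bar>"
    by linarith
  then show ?thesis
    by cases (erule (1) sorted_case; use rep(2) in auto)+
qed

section \<open>The exceptional lines\<close>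

lemma admissible_sum_line_0_3_6:
  assumes "u \<noteq> 0" "\<bar>e\<bar> = 1"
  shows "admissible_sum (9 * (0\<^sup>2 + (3 * u - e)\<^sup>2 + (6 * u - e)\<^sup>2))"
proof -
  let ?a = "2 * u" and ?b = "5 * u - e" and ?c = "4 * u - e"
  have "\<not> reflects_to_unit ?a ?b ?c" "\<not> reflects_to_unit ?a (- ?b) ?c"
    using assms unfolding reflects_to_unit_def by auto
  moreover have "\<not> 3 dvd ?a + ?c"
    using assms(2) by presburger
  ultimately have "admissible_sum (9 * (?a\<^sup>2 + ?b\<^sup>2 + ?c\<^sup>2))"
    by (intro admissible_sum_reflection_middle_sign)
  also have "?a\<^sup>2 + ?b\<^sup>2 + ?c\<^sup>2 = 0\<^sup>2 + (3 * u - e)\<^sup>2 + (6 * u - e)\<^sup>2"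
    by (simp add: power2_eq_square algebra_simps)
  finally show ?thesis .
qed

lemma admissible_sum_line_6_6_9:
  assumes "u \<noteq> 0"
  shows "admissible_sum (9 * ((6 * u - 1)\<^sup>2 + (6 * u + 1)\<^sup>2 + (9 * u)\<^sup>2))"
proof -
  let ?a = "4 * u - 1" and ?b = "4 * u + 1" and ?c = "11 * u"
  have "\<not> reflects_to_unit ?a ?b ?c" "\<not> reflects_to_unit ?a (- ?b) ?c"
    using assms unfolding reflects_to_unit_def by auto
  moreover have "\<not> 3 dvd ?a + ?c"
    by presburger
  ultimately have "admissible_sum (9 * (?a\<^sup>2 + ?b\<^sup>2 + ?c\<^sup>2))"
    by (intro admissible_sum_reflection_middle_sign)
  also have "?a\<^sup>2 + ?b\<^sup>2 + ?c\<^sup>2 = (6 * u - 1)\<^sup>2 + (6 * u + 1)\<^sup>2 + (9 * u)\<^sup>2"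
    by (simp add: power2_eq_square algebra_simps)
  finally show ?thesis .
qed

lemma admissible_sum_line_6_15_18:
  assumes "u \<noteq> 0" "\<bar>e\<bar> = 1"
  shows "admissible_sum (9 * ((6 * u + e)\<^sup>2 + (15 * u + 2 * e)\<^sup>2 + (18 * u + 3 * e)\<^sup>2))"
proof -
  let ?a = "4 * u + e" and ?b = "13 * u + 2 * e" and ?c = "20 * u + 3 * e"
  have "\<not> reflects_to_unit ?a ?b ?c" "\<not> reflects_to_unit ?a (- ?b) ?c"
    using assms unfolding reflects_to_unit_def by auto
  moreover have "\<not> 3 dvd ?a + ?c"
    using assms(2) by presburger
  ultimately have "admissible_sum (9 * (?a\<^sup>2 + ?b\<^sup>2 + ?c\<^sup>2))"
    by (intro admissible_sum_reflection_middle_sign)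
  also have "?a\<^sup>2 + ?b\<^sup>2 + ?c\<^sup>2 = (6 * u + e)\<^sup>2 + (15 * u + 2 * e)\<^sup>2 + (18 * u + 3 * e)\<^sup>2"
    by (simp add: power2_eq_square algebra_simps)
  finally show ?thesis .
qed

section \<open>Sorted representations\<close>

context
  fixes a b c :: int
  assumes sorted: "0 \<le> a" "a \<le> b" "b \<le> c" and large: "2 \<le> c"
begin

lemma two_le_reflection_entries:
  "2 \<le> 2 * b + 2 * c - a" "2 \<le> 2 * a + 2 * c - b" "2 \<le> 2 * a + 2 * b + c"
  "2 \<le> 2 * b + 2 * c + a" "2 \<le> 2 * a + 2 * c + b" "2 \<le> 2 * b + c - 2 * a" "2 \<le> 2 * c + b - 2 * a"
  using sorted large by linarith+

lemma reflects_to_unit_iff_if_sorted: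
  shows "reflects_to_unit a b c \<longleftrightarrow> \<bar>2 * a + 2 * b - c\<bar> = 1"
    and "reflects_to_unit (- a) b c \<longleftrightarrow> \<bar>2 * c - 2 * a - b\<bar> = 1 \<or> \<bar>2 * b - 2 * a - c\<bar> = 1"
    and "reflects_to_unit a (- b) c \<longleftrightarrow> \<bar>2 * c - 2 * b - a\<bar> = 1"
    and "reflects_to_unit a b (- c) \<longleftrightarrow> \<bar>2 * c - 2 * b + a\<bar> = 1"
  using two_le_reflection_entries unfolding reflects_to_unit_def by auto

lemma admissible_sum_if_not_3_dvd_signed_sum:
  assumes "\<not> 3 dvd a + b - c"
  shows "admissible_sum (9 * (a\<^sup>2 + b\<^sup>2 + c\<^sup>2))"
proof (cases "reflects_to_unit a b (- c)")
  case True
  then have "b = c"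
    using sorted unfolding reflects_to_unit_iff_if_sorted by linarith
  with True have "a = 1"
    using sorted(1) unfolding reflects_to_unit_iff_if_sorted by linarith
  with \<open>b = c\<close> have "\<not> 3 dvd a + b + c \<and> \<not> reflects_to_unit a b c
      \<or> \<not> 3 dvd - a + b + c \<and> \<not> reflects_to_unit (- a) b c"
    using large unfolding reflects_to_unit_iff_if_sorted by presburger
  then show ?thesis
    by (blast intro: admissible_sum_reflection admissible_sum_reflection_signs(1))
next
  case False
  with assms show ?thesis
    by (rule admissible_sum_reflection_signs(3))
qed

lemma admissible_sum_if_not_3_dvd_extremes:
  assumes "3 dvd a + b - c" "\<not> 3 dvd a" "\<not> 3 dvd c"
  shows "admissible_sum (9 * (a\<^sup>2 + b\<^sup>2 + c\<^sup>2))"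
proof -
  have "a \<noteq> 0" using assms(2) by auto
  then have "\<not> reflects_to_unit a b c \<or> \<not> reflects_to_unit a (- b) c"
    using sorted unfolding reflects_to_unit_iff_if_sorted by linarith
  moreover have "\<not> 3 dvd a + b + c" "\<not> 3 dvd a - b + c"
    using assms by presburger+
  ultimately show ?thesis
    by (blast intro: admissible_sum_reflection admissible_sum_reflection_signs(2))
qed

lemma reflects_to_unit_line_0_3_6E:
  assumes "3 dvd b - c"
    and "reflects_to_unit a b c" "reflects_to_unit (- a) b c"
  obtains u e where "\<bar>e\<bar> = 1" "a = 0" "b = 3 * u - e" "c = 6 * u - e"
proof -
  define e where "e = c - 2 * b"
  have "a = 0"
    using assms(2,3) sorted large unfolding reflects_to_unit_iff_if_sorted by arith
  moreover have "\<bar>e\<bar> = 1"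
    using assms(2) \<open>a = 0\<close> unfolding reflects_to_unit_iff_if_sorted e_def by linarith
  moreover obtain k where "b - c = 3 * k"
    using assms(1) by blast
  then have "b = 3 * (- k) - e" "c = 6 * (- k) - e"
    unfolding e_def by linarith+
  ultimately show thesis using that by blast
qed

lemma reflects_to_unit_lines_6_6_9_6_15_18E:
  assumes "3 dvd a + b" "3 dvd c" "\<not> 3 dvd a"
    and "reflects_to_unit a (- b) c" "reflects_to_unit (- a) b c"
  obtains (line_6_6_9) u where "a = 6 * u - 1" "b = 6 * u + 1" "c = 9 * u"
    | (line_6_15_18) u e where "\<bar>e\<bar> = 1" "a = 6 * u + e" "b = 15 * u + 2 * e" "c = 18 * u + 3 * e"
proof -
  define e where "e = 2 * c - 2 * b - a"
  have unit: "\<bar>e\<bar> = 1"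
    using assms(4) unfolding reflects_to_unit_iff_if_sorted e_def by simp
  consider (second_entry) "\<bar>2 * c - 2 * a - b\<bar> = 1" | (third_entry) "\<bar>2 * b - 2 * a - c\<bar> = 1"
    using assms(5) unfolding reflects_to_unit_iff_if_sorted by blast
  then show thesis
  proof cases
    case second_entry
    have "a \<noteq> b" using assms(1,3) by presburger
    then have "b = a + 2" "2 * c = 3 * a + 3"
      using second_entry unit sorted(2) unfolding e_def by linarith+
    moreover from this have "9 dvd c"
      using assms(1,2) by presburger
    then obtain u where "c = 9 * u" ..
    ultimately show thesis using line_6_6_9[of u] by simp
  next
    case third_entry
    define f where "f = 2 * b - 2 * a - c"
    have "c = 3 * a + (e + f)"
      unfolding e_def f_def by simp
    moreover from this have "f = - e"
      using third_entry[folded f_def] unit assms(2) by presburger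
    ultimately have "2 * b = 5 * a - e" "c = 3 * a"
      unfolding f_def by linarith+
    moreover from this have "6 dvd a - e"
      using unit assms(1) by presburger
    then obtain u where "a - e = 6 * u" ..
    ultimately show thesis using line_6_15_18[of e u] unit by simp
  qed
qed

lemma admissible_sum_if_3_dvd_smallest:
  assumes "3 dvd b - c" "3 dvd a" "\<not> 3 dvd b"
  shows "admissible_sum (9 * (a\<^sup>2 + b\<^sup>2 + c\<^sup>2))"
proof (cases "reflects_to_unit a b c \<and> reflects_to_unit (- a) b c")
  case True
  then obtain u e where "\<bar>e\<bar> = 1" "a = 0" "b = 3 * u - e" "c = 6 * u - e"
    using reflects_to_unit_line_0_3_6E assms(1) by blast
  moreover from this have "u \<noteq> 0" using large by auto
  ultimately show ?thesis
    using admissible_sum_line_0_3_6 by blast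
next
  case False
  moreover have "\<not> 3 dvd a + b + c" "\<not> 3 dvd - a + b + c"
    using assms by presburger+
  ultimately show ?thesis
    by (blast intro: admissible_sum_reflection admissible_sum_reflection_signs(1))
qed

lemma admissible_sum_if_3_dvd_largest:
  assumes "3 dvd a + b" "3 dvd c" "\<not> 3 dvd a"
    and "a\<^sup>2 + b\<^sup>2 + c\<^sup>2 \<noteq> 14"
  shows "admissible_sum (9 * (a\<^sup>2 + b\<^sup>2 + c\<^sup>2))"
proof (cases "reflects_to_unit a (- b) c \<and> reflects_to_unit (- a) b c")
  case True
  then consider (line_6_6_9) u where "a = 6 * u - 1" "b = 6 * u + 1" "c = 9 * u"
    | (line_6_15_18) u e where "\<bar>e\<bar> = 1" "a = 6 * u + e" "b = 15 * u + 2 * e" "c = 18 * u + 3 * e"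
    using reflects_to_unit_lines_6_6_9_6_15_18E assms(1-3) by blast
  then show ?thesis
  proof cases
    case line_6_6_9
    moreover from this have "u \<noteq> 0" using large by auto
    ultimately show ?thesis
      using admissible_sum_line_6_6_9 by blast
  next
    case line_6_15_18
    have "u \<noteq> 0"
    proof
      assume "u = 0"
      then have "a = 1" "b = 2" "c = 3"
        using line_6_15_18 sorted(1) by linarith+
      then show False using assms(4) by simp
    qed
    with line_6_15_18 show ?thesis
      using admissible_sum_line_6_15_18 by blast
  qed
next
  case False
  moreover have "\<not> 3 dvd a - b + c" "\<not> 3 dvd - a + b + c"
    using assms(1-3) by presburger+
  ultimately show ?thesis
    by (blast intro: admissible_sum_reflection_signs)
qed

lemma admissible_sum_if_sorted:
  assumes "\<not> (3 dvd a \<and> 3 dvd b \<and> 3 dvd c)" "a\<^sup>2 + b\<^sup>2 + c\<^sup>2 \<noteq> 14"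
  shows "admissible_sum (9 * (a\<^sup>2 + b\<^sup>2 + c\<^sup>2))"
proof -
  have "\<not> 3 dvd a + b - c \<or> 3 dvd a + b - c \<and> \<not> 3 dvd a \<and> \<not> 3 dvd c
      \<or> 3 dvd b - c \<and> 3 dvd a \<and> \<not> 3 dvd b \<or> 3 dvd a + b \<and> 3 dvd c \<and> \<not> 3 dvd a"
    using assms(1) by presburger
  then show ?thesis
    using admissible_sum_if_not_3_dvd_signed_sum admissible_sum_if_not_3_dvd_extremes
      admissible_sum_if_3_dvd_smallest admissible_sum_if_3_dvd_largest[OF _ _ _ assms(2)] by blast
qed

end

theorem theorem4p2:
  fixes m :: int
  assumes "m > 0"
    and "\<exists>a b c :: int. m = a\<^sup>2 + b\<^sup>2 + c\<^sup>2"
    and "m \<notin> {1, 2, 3, 14}"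
  shows "\<exists>x y z :: int. x\<^sup>2 + y\<^sup>2 + z\<^sup>2 = 9 * m
           \<and> \<not> [x * y * z = 0] (mod 3)
           \<and> (x\<^sup>2 - 1) * (y\<^sup>2 - 1) * (z\<^sup>2 - 1) \<noteq> 0"
proof -
  obtain a b c where m: "m = a\<^sup>2 + b\<^sup>2 + c\<^sup>2" and sorted: "0 \<le> a" "a \<le> b" "b \<le> c"
    and "\<not> (3 dvd a \<and> 3 dvd b \<and> 3 dvd c)"
    using assms(1,2) exists_sorted_rep_not_all_3_dvd by blast
  moreover have "2 \<le> c"
  proof (rule ccontr)
    assume "\<not> 2 \<le> c"
    then have "a \<in> {0, 1}" "b \<in> {0, 1}" "c \<in> {0, 1}" using sorted by auto
    then show False using assms(1,3) m by auto
  qed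
  ultimately have "admissible_sum (9 * m)"
    using admissible_sum_if_sorted assms(3) by blast
  then obtain x y z where "9 * m = x\<^sup>2 + y\<^sup>2 + z\<^sup>2" "\<not> 3 dvd x * y * z"
    "\<bar>x\<bar> \<noteq> 1" "\<bar>y\<bar> \<noteq> 1" "\<bar>z\<bar> \<noteq> 1"
    unfolding admissible_sum_def by (auto simp: prime_dvd_mult_iff)
  then show ?thesis
    by (intro exI[of _ x] exI[of _ y] exI[of _ z])
      (auto simp: cong_0_iff power2_eq_1_iff)
qed

end
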